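(* Let $f(n)=c_dn^d+c_{d-1}n^{d-1}+\dots+c_1n+c_0$ be a non-constant polynomial with real coefficients such that $f(n)\in\mathbb{N}$ for every $n\in\mathbb{N}$. For each $n\in\mathbb{N}$ let $x_n=0.f(n)f(n+1)f(n+2)f(n+3)\dots$ be the real number whose decimal expansion after the decimal point is obtained by concatenating the decimal representations of $f(n),f(n+1),f(n+2),\dots$ in this order. Then the sequence $(x_n)_n$ is not uniformly distributed modulo $1$ over $[0.1,1)$.
   Context: $\mathbb{N}=\{1,2,3,\dots\}$. For a real number $x$, $\{x\}$ denotes its fractional part. For a sequence of real numbers $(x_n)_n$, a set $E\subseteq[0,1]$ and $N\ge 1$, $A(E;N;(x_n)_n)$ denotes the number of indices $n$ with $1\le n\le N$ and $\{x_n\}\in E$. A sequence $(x_n)_n$ is called uniformly distributed modulo $1$ over $[\alpha,\beta)\subseteq[0,1)$ if for every pair of reals $\alpha\le a<b\le\beta$, $$\lim_{N\to\infty}\frac{A([a,b);N;(x_n)_n)}{N}=\frac{b-a}{\beta-\alpha}.$$ *)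

theory Defs
  imports
    Complex_Main
    "HOL-Library.Stream"
    "HOL-Computational_Algebra.Polynomial"
begin

text \<open>Decimal digits, most significant first and without leading zeros; 0 is represented by [0].\<close>

fun decimal_digits :: "nat \<Rightarrow> nat list" where
  "decimal_digits m = (if m < 10 then [m] else decimal_digits (m div 10) @ [m mod 10])"

declare decimal_digits.simps [simp del]

text \<open>The digit sequence of f(n) f(n+1) f(n+2) ... . The junk behaviour of \<^const>\<open>flat\<close> on empty
  lists is irrelevant, since \<^const>\<open>decimal_digits\<close> never returns one.\<close>

definition concat_digits :: "(nat \<Rightarrow> nat) \<Rightarrow> nat \<Rightarrow> nat stream" where
  "concat_digits f n = flat (smap (\<lambda>m. decimal_digits (f m)) (fromN n))"

definition decimal_value :: "nat stream \<Rightarrow> real" where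
  "decimal_value ds = (\<Sum>k. real (ds !! k) / 10 ^ (k + 1))"

definition concat_real :: "(nat \<Rightarrow> nat) \<Rightarrow> nat \<Rightarrow> real" where
  "concat_real f n = decimal_value (concat_digits f n)"

text \<open>Sequences are indexed from 1; the value at index 0 is never used.\<close>

definition count_mod1 :: "real set \<Rightarrow> nat \<Rightarrow> (nat \<Rightarrow> real) \<Rightarrow> nat" where
  "count_mod1 E N x = card {n. 1 \<le> n \<and> n \<le> N \<and> frac (x n) \<in> E}"

text \<open>Only meaningful for \<open>0 \<le> \<alpha> < \<beta> \<le> 1\<close>.\<close>

definition uniformly_distributed_mod1_over :: "(nat \<Rightarrow> real) \<Rightarrow> real \<Rightarrow> real \<Rightarrow> bool" where
  "uniformly_distributed_mod1_over x \<alpha> \<beta> \<longleftrightarrow>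
     (\<forall>a b. \<alpha> \<le> a \<and> a < b \<and> b \<le> \<beta> \<longrightarrow>
        (\<lambda>N. real (count_mod1 {a..<b} N x) / real N) \<longlonglongrightarrow> (b - a) / (\<beta> - \<alpha>))"

end

theory Submission imports Defs begin

text \<open>Suppose \<open>f n\<close> lies in \<open>[2 * 10^k, 10^(k+1))\<close>; then the first digit of \<open>x\<^sub>n\<close> is at least 2.
  As \<open>f\<close> grows like \<open>n^d\<close>, the indices \<open>n\<close> with this property fill an interval \<open>(M, N]\<close> with \<open>N/M\<close>
  bounded away from 1, arbitrarily far out. The counting function of \<open>[1/10, 1/5)\<close> is constant on
  such an interval, which is incompatible with a positive limiting frequency.\<close>

section \<open>Decimal digits and the leading digit of the concatenated number\<close>

lemma decimal_digits_nonempty: "decimal_digits m \<noteq> []"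
  by (simp add: decimal_digits.simps[of m])

text \<open>Deleting the last digit of a number with several digits keeps the head and turns
  \<open>m\<close> into \<open>m div 10\<close>, for which both bounds hold with the exponent
  lowered by one.\<close>

lemma hd_decimal_digits_ge:
  assumes "c * 10 ^ k \<le> m" "m < 10 ^ (k + 1)"
  shows "c \<le> hd (decimal_digits m)"
  using assms
proof (induction k arbitrary: m)
  case 0
  then show ?case by (simp add: decimal_digits.simps[of m])
next
  case (Suc k)
  show ?case
  proof (cases "m < 10")
    case True
    have "c * 1 \<le> c * 10 ^ Suc k" by (intro mult_le_mono) auto
    with Suc.prems(1) have "c \<le> m" by linarith
    with True show ?thesis by (simp add: decimal_digits.simps[of m])
  next
    case False
    have "c \<le> hd (decimal_digits (m div 10))"
      using Suc.prems by (intro Suc.IH) auto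
    with False show ?thesis by (simp add: decimal_digits.simps[of m] decimal_digits_nonempty)
  qed
qed

lemma decimal_digits_le: "x \<in> set (decimal_digits m) \<Longrightarrow> x \<le> 9"
proof (induction m rule: decimal_digits.induct)
  case (1 m)
  then show ?case
    by (cases "m < 10") (auto simp: decimal_digits.simps[of m])
qed

lemma concat_digits_le: "concat_digits f n !! k \<le> 9"
proof -
  have "sset (concat_digits f n) \<subseteq> {..9}"
    unfolding concat_digits_def
    by (subst sset_flat) (auto simp: decimal_digits_nonempty stream.set_map dest: decimal_digits_le)
  then show ?thesis by (meson atMost_iff snth_sset subsetD)
qed

lemma concat_digits_0: "concat_digits f n !! 0 = hd (decimal_digits (f n))"
  unfolding concat_digits_def
  by (subst siterate.code) (simp add: decimal_digits_nonempty)

text \<open>Termwise comparison with 0.999... = 1 from above and with the first term alone from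
  below.\<close>

lemma decimal_value_bounds:
  assumes "\<And>k. ds !! k \<le> 9"
  shows "real (ds !! 0) / 10 \<le> decimal_value ds" "decimal_value ds \<le> 1"
proof -
  have nines: "(\<lambda>k. 9 / 10 ^ (k + 1) :: real) sums 1"
    using sums_mult[OF geometric_sums[of "1/10 :: real"], of "9/10"]
    by (simp add: power_divide)
  have le: "real (ds !! k) / 10 ^ (k + 1) \<le> 9 / 10 ^ (k + 1)" for k
    using assms[of k] by (intro divide_right_mono) auto
  have summ: "summable (\<lambda>k. real (ds !! k) / 10 ^ (k + 1))"
    by (rule summable_comparison_test'[OF sums_summable[OF nines], of 0]) (use le in auto)
  show "decimal_value ds \<le> 1"
    unfolding decimal_value_def sums_unique[OF nines]
    by (rule suminf_le[OF le summ sums_summable[OF nines]])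
  show "real (ds !! 0) / 10 \<le> decimal_value ds"
    unfolding decimal_value_def using sum_le_suminf[OF summ, of "{0}"] by simp
qed

lemma frac_concat_real_notin:
  assumes "2 * 10 ^ k \<le> f n" "f n < 10 ^ (k + 1)"
  shows "frac (concat_real f n) \<notin> {1/10..<1/5}"
proof -
  have "2 \<le> concat_digits f n !! 0"
    unfolding concat_digits_0 using assms by (rule hd_decimal_digits_ge)
  then have lower: "1/5 \<le> concat_real f n"
    using decimal_value_bounds(1)[of "concat_digits f n", OF concat_digits_le]
    unfolding concat_real_def by linarith
  have upper: "concat_real f n \<le> 1"
    unfolding concat_real_def by (rule decimal_value_bounds(2)[OF concat_digits_le])
  show ?thesis
  \<comment> \<open>The digit bounds alone leave the value 1 open; its fractional part 0 lies
    outside the interval too.\<close>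
  proof (cases "concat_real f n = 1")
    case False
    then have "frac (concat_real f n) = concat_real f n"
      using lower upper by (simp add: frac_eq)
    with lower show ?thesis by simp
  qed simp
qed

section \<open>Counting functions and their densities\<close>

lemma count_mod1_eq:
  assumes "M \<le> N" "\<And>n. M < n \<Longrightarrow> n \<le> N \<Longrightarrow> frac (x n) \<notin> E"
  shows "count_mod1 E N x = count_mod1 E M x"
proof -
  have "{n. 1 \<le> n \<and> n \<le> N \<and> frac (x n) \<in> E} = {n. 1 \<le> n \<and> n \<le> M \<and> frac (x n) \<in> E}"
    using assms by (auto simp: not_le intro: ccontr)
  then show ?thesis by (simp add: count_mod1_def)
qed

text \<open>If \<open>A N = A M\<close>, then passing from \<open>M\<close> to \<open>N\<close>
  divides the frequency by at least \<open>1 + \<delta>\<close>, which is impossible once both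
  frequencies are close to \<open>L\<close>.\<close>

lemma density_not_constant_on_long_intervals:
  fixes A :: "nat \<Rightarrow> nat" and L \<delta> :: real
  assumes lim: "(\<lambda>N. real (A N) / real N) \<longlonglongrightarrow> L" and "L > 0" "\<delta> > 0"
  shows "\<exists>B. \<forall>M\<ge>B. \<forall>N. (1 + \<delta>) * real M \<le> real N \<longrightarrow> A N \<noteq> A M"
proof -
  \<comment> \<open>The window from \<open>L / r\<close> to \<open>L * r\<close> has endpoints in
    the exact ratio \<open>1 + \<delta>\<close>.\<close>
  define r where "r = sqrt (1 + \<delta>)"
  have r: "r > 1" "r * r = 1 + \<delta>" using \<open>\<delta> > 0\<close> by (auto simp: r_def)
  have "\<forall>\<^sub>F N in sequentially. L / r < real (A N) / real N \<and> real (A N) / real N < L * r"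
    using r \<open>L > 0\<close>
    by (intro eventually_conj order_tendstoD[OF lim]) (auto simp: field_simps)
  then obtain B where B: "\<And>N. N \<ge> B \<Longrightarrow> L / r < real (A N) / real N \<and> real (A N) / real N < L * r"
    by (auto simp: eventually_sequentially)
  show ?thesis
  \<comment> \<open>The threshold must be at least 1, since \<open>M = N = 0\<close> would be a
    counterexample.\<close>
  proof (intro exI[of _ "max 1 B"] allI impI notI)
    fix M N assume M: "max 1 B \<le> M" and N: "(1 + \<delta>) * real M \<le> real N" and eq: "A N = A M"
    have "1 * real M \<le> (1 + \<delta>) * real M" using \<open>\<delta> > 0\<close> by (intro mult_right_mono) auto
    with N have "real M \<le> real N" by linarith
    with M have MN: "M \<le> N" "0 < M" by auto
    have "real (A M) < L * r * real M" using B[of M] M MN by (auto simp: field_simps)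
    also have "\<dots> = L / r * ((1 + \<delta>) * real M)" using r(1) by (simp flip: r(2))
    also have "\<dots> \<le> L / r * real N" using N r \<open>L > 0\<close> by (intro mult_left_mono) auto
    also have "\<dots> < real (A N)" using B[of N] M MN by (auto simp: field_simps)
    finally show False using eq by simp
  qed
qed

section \<open>Behaviour of real polynomials at large arguments\<close>

lemma lead_coeff_pos_if_positive_at_nats:
  fixes p :: "real poly"
  assumes "\<And>n::nat. n \<ge> 1 \<Longrightarrow> poly p (real n) > 0"
  shows "lead_coeff p > 0"
proof (rule ccontr)
  assume "\<not> lead_coeff p > 0"
  moreover have "p \<noteq> 0" using assms[of 1] by auto
  ultimately have "lead_coeff (- p) > 0"
    by (metis lead_coeff_minus leading_coeff_0_iff neg_0_less_iff_less linorder_neqE_linordered_idom)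
  \<comment> \<open>So \<open>p\<close> is negative from \<open>b\<close> on, in particular at some
    large natural number.\<close>
  then obtain b where b: "\<And>x. x \<ge> b \<Longrightarrow> poly (- p) x \<ge> lead_coeff (- p)"
    using poly_pinfty_gt_lc by metis
  obtain n :: nat where "max 1 b \<le> real n" using real_arch_simple by blast
  with b[of "real n"] assms[of n] \<open>lead_coeff (- p) > 0\<close> show False by simp
qed

text \<open>Since \<open>p\<close> is not constant, subtracting \<open>c\<close> leaves its leading
  coefficient unchanged.\<close>

lemma poly_eventually_gt:
  fixes p :: "real poly"
  assumes "degree p > 0" "lead_coeff p > 0"
  shows "\<exists>b. \<forall>x\<ge>b. poly p x > c"
proof -
  have "degree (p - [:c:]) = degree p"
    using degree_add_eq_left[of "- [:c:]" p] assms(1) by (simp only: diff_conv_add_uminus degree_minus degree_pCons_0)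
  then have "lead_coeff (p - [:c:]) > 0"
    using assms by (cases "degree p") simp_all
  then obtain b where b: "\<And>x. x \<ge> b \<Longrightarrow> poly (p - [:c:]) x \<ge> lead_coeff (p - [:c:])"
    using poly_pinfty_gt_lc by metis
  have "poly p x > c" if "x \<ge> b" for x
    using b[OF that] \<open>lead_coeff (p - [:c:]) > 0\<close> by simp
  then show ?thesis by blast
qed

lemma poly_eventually_mono:
  fixes p :: "real poly"
  assumes "degree p > 0" "lead_coeff p > 0"
  shows "\<exists>b. \<forall>x y. b \<le> x \<longrightarrow> x \<le> y \<longrightarrow> poly p x \<le> poly p y"
proof -
  have "lead_coeff (pderiv p) > 0"
    using assms by (simp add: degree_pderiv coeff_pderiv)
  then obtain b where b: "\<And>x. x \<ge> b \<Longrightarrow> poly (pderiv p) x \<ge> lead_coeff (pderiv p)"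
    using poly_pinfty_gt_lc by metis
  have "poly p x \<le> poly p y" if "b \<le> x" "x \<le> y" for x y
    using \<open>x \<le> y\<close>
  proof (rule DERIV_nonneg_imp_nondecreasing)
    fix z assume "x \<le> z"
    with b[of z] \<open>b \<le> x\<close> \<open>lead_coeff (pderiv p) > 0\<close>
    show "\<exists>y. (poly p has_real_derivative y) (at z) \<and> 0 \<le> y"
      by (intro exI[of _ "poly (pderiv p) z"]) (auto simp: poly_DERIV)
  qed
  then show ?thesis by blast
qed

lemma poly_dilation_le:
  fixes p :: "real poly" and r C :: real
  assumes "lead_coeff p > 0" "r \<noteq> 0" "r ^ degree p < C"
  shows "\<exists>b. \<forall>x\<ge>b. poly p (r * x) \<le> C * poly p x"
proof -
  \<comment> \<open>The coefficient of \<open>q\<close> at \<open>degree p\<close> is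
    \<open>(C - r ^ degree p) * lead_coeff p\<close>, which is positive, so \<open>q\<close> is
    eventually positive.\<close>
  define q where "q = smult C p - pcompose p [:0, r:]"
  have deg: "degree (pcompose p [:0, r:]) = degree p"
    using \<open>r \<noteq> 0\<close> by (simp add: degree_pcompose)
  have lc: "coeff (pcompose p [:0, r:]) (degree p) = lead_coeff p * r ^ degree p"
    using lead_coeff_comp[of "[:0, r:]" p] \<open>r \<noteq> 0\<close> deg by simp
  have pos: "coeff q (degree p) > 0"
    using assms lc by (simp add: q_def algebra_simps)
  have "degree q \<le> degree p"
    unfolding q_def using deg by (intro degree_diff_le) auto
  then have "degree q = degree p" using pos le_degree[of q "degree p"] by simp
  then have "lead_coeff q > 0" using pos by simp
  then obtain b where b: "\<And>x. x \<ge> b \<Longrightarrow> poly q x \<ge> lead_coeff q"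
    using poly_pinfty_gt_lc by metis
  have "poly p (r * x) \<le> C * poly p x" if "x \<ge> b" for x
    using b[OF that] \<open>lead_coeff q > 0\<close> by (simp add: q_def poly_pcompose mult.commute)
  then show ?thesis by blast
qed

theorem theorem3:
  fixes p :: "real poly" and f :: "nat \<Rightarrow> nat"
  assumes "degree p > 0"
    and "\<And>n. n \<ge> 1 \<Longrightarrow> f n \<ge> 1 \<and> poly p (real n) = real (f n)"
  shows "\<not> uniformly_distributed_mod1_over (\<lambda>n. concat_real f n) (1/10) 1"
proof
  assume ud: "uniformly_distributed_mod1_over (\<lambda>n. concat_real f n) (1/10) 1"
  define A where "A N = count_mod1 {1/10..<1/5} N (concat_real f)" for N
  define d where "d = degree p"
  have d: "d > 0" using assms(1) by (simp add: d_def)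
  have pf: "poly p (real n) = real (f n)" if "n \<ge> 1" for n using assms(2) that by blast
  have lc: "lead_coeff p > 0"
    by (rule lead_coeff_pos_if_positive_at_nats) (use assms(2) in force)
  have "(\<lambda>N. real (A N) / real N) \<longlonglongrightarrow> (1/5 - 1/10) / (1 - 1/10)"
    using ud unfolding uniformly_distributed_mod1_over_def A_def
    by (elim allE[of _ "1/10"] allE[of _ "1/5"] impE) auto
  \<comment> \<open>The interval will have length \<open>M div d\<close>; halving
    \<open>1 / d\<close> absorbs the loss from rounding down.\<close>
  from density_not_constant_on_long_intervals[OF this, of "1 / (2 * real d)"] d
  obtain B where B: "\<And>M N. M \<ge> B \<Longrightarrow> (1 + 1 / (2 * real d)) * real M \<le> real N \<Longrightarrow> A N \<noteq> A M"
    by auto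
  obtain b1 where mono: "\<And>x y. b1 \<le> x \<Longrightarrow> x \<le> y \<Longrightarrow> poly p x \<le> poly p y"
    using poly_eventually_mono[OF assms(1) lc] by blast
  \<comment> \<open>Stretching the argument by \<open>1 + 1 / d\<close> multiplies \<open>p\<close>
    asymptotically by at most e. The factor 4 leaves room for this and still keeps values below
    \<open>2 * 10 ^ k\<close> under \<open>10 ^ (k + 1)\<close>.\<close>
  have "(1 + 1 / real d) ^ d \<le> exp (1 / real d) ^ d"
    by (intro power_mono exp_ge_add_one_self) auto
  also have "\<dots> = exp 1" using d by (simp flip: exp_of_nat_mult)
  also have "\<dots> < 4" using exp_le by linarith
  finally have "(1 + 1 / real d) ^ degree p < 4" by (simp add: d_def)
  moreover have "1 + 1 / real d > 0" by (intro add_pos_nonneg) auto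
  ultimately obtain b2 where dil: "\<And>x. x \<ge> b2 \<Longrightarrow> poly p ((1 + 1 / real d) * x) \<le> 4 * poly p x"
    using poly_dilation_le[OF lc, of "1 + 1 / real d" 4] by auto
  obtain n0 :: nat where n0: "max b1 b2 \<le> real n0" using real_arch_simple by blast
  define m where "m = max (max B (2 * d)) (max 1 n0)"
  \<comment> \<open>Any \<open>k\<close> with \<open>f m < 2 * 10 ^ k\<close> will do: it makes the
    last index below that bound at least \<open>m\<close>, hence beyond all thresholds.\<close>
  have "f m < 10 ^ f m"
    using less_exp[of "f m"] power_mono[of "2::nat" 10 "f m"] by linarith
  then obtain k where k: "f m < 2 * 10 ^ k" by (metis mult_2 trans_less_add1)
  obtain b3 where b3: "\<And>x. x \<ge> b3 \<Longrightarrow> 2 * 10 ^ k < poly p x"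
    using poly_eventually_gt[OF assms(1) lc] by blast
  have bound: "n \<le> nat \<lceil>b3\<rceil>" if "1 \<le> n \<and> f n < 2 * 10 ^ k" for n
  proof (rule ccontr)
    assume "\<not> n \<le> nat \<lceil>b3\<rceil>"
    then have "2 * 10 ^ k < real (f n)"
      using b3[of "real n"] pf[of n] that by linarith
    also have "\<dots> < real (2 * 10 ^ k)" using that by (simp only: of_nat_less_iff)
    finally show False by simp
  qed
  \<comment> \<open>As \<open>f\<close> may fluctuate at first, the last index below
    \<open>2 * 10 ^ k\<close> is taken; it exists by \<open>bound\<close>, and every later index
    satisfies the lower bound on \<open>f\<close>.\<close>
  define M where "M = (GREATEST n. 1 \<le> n \<and> f n < 2 * 10 ^ k)"
  have "m \<ge> 1" by (simp add: m_def)
  have M: "1 \<le> M \<and> f M < 2 * 10 ^ k"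
    unfolding M_def by (rule GreatestI_nat[of _ m]) (use k bound \<open>m \<ge> 1\<close> in auto)
  have "m \<le> M"
    unfolding M_def by (rule Greatest_le_nat[of _ m]) (use k bound \<open>m \<ge> 1\<close> in auto)
  then have M_ge: "M \<ge> B" "M \<ge> 2 * d" "real M \<ge> b1" "real M \<ge> b2"
    using n0 by (auto simp: m_def)
  define N where "N = M + M div d"
  have "real (M div d) \<le> real M / real d" using of_nat_div_le_of_nat[of M d] by simp
  then have N_le: "real N \<le> (1 + 1 / real d) * real M"
    by (simp add: N_def algebra_simps)
  \<comment> \<open>Rounding loses less than \<open>d\<close>, which is at most half of
    \<open>M\<close>.\<close>
  have "M < d * (M div d) + d" using dividend_less_times_div[OF d, of M] by simp
  then have "M \<le> 2 * (d * (M div d))" using M_ge(2) by linarith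
  then have "real M \<le> 2 * (real d * real (M div d))"
    by (metis of_nat_le_iff of_nat_mult of_nat_numeral)
  then have N_ge: "(1 + 1 / (2 * real d)) * real M \<le> real N"
    using d by (simp add: N_def field_simps)
  have "A N = A M"
    unfolding A_def
  proof (rule count_mod1_eq)
    fix n assume n: "M < n" "n \<le> N"
    have "2 * 10 ^ k \<le> f n"
    proof (rule ccontr)
      assume "\<not> 2 * 10 ^ k \<le> f n"
      then have "n \<le> M"
        unfolding M_def by (intro Greatest_le_nat) (use bound n in auto)
      with n show False by simp
    qed
    moreover have "f n < 10 ^ (k + 1)"
    proof -
      have "real (f n) = poly p (real n)" using pf[of n] n by simp
      \<comment> \<open>Monotonicity moves \<open>n\<close> to the end of the stretched interval,
        and dilation compares that value with \<open>f M\<close>.\<close>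
      also have "\<dots> \<le> poly p ((1 + 1 / real d) * real M)"
        using n N_le M_ge by (intro mono) auto
      also have "\<dots> \<le> 4 * poly p (real M)" using M_ge by (intro dil)
      also have "\<dots> = real (4 * f M)" using pf[of M] M by simp
      finally have "f n \<le> 4 * f M" by (simp only: of_nat_le_iff)
      with M show ?thesis by simp
    qed
    ultimately show "frac (concat_real f n) \<notin> {1/10..<1/5}" by (rule frac_concat_real_notin)
  qed (simp add: N_def)
  with B[OF M_ge(1) N_ge] show False by simp
qed

end
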